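(* Let $v\in\mathbb C^n$ be a non-zero element. Then the $2n$-dimensional vector space $$\mathcal E(v)=\{\phi_{ab}(g)=\mathrm{trace}(a^tv(x+iy)^t+b^tv(z+iw)^t)\ |\ a,b\in\mathbb C^n\}$$ of functions on $\mathrm{Sp}(n,\mathbb R)$ is an eigenfamily on $\mathrm{Sp}(n,\mathbb R)$, where $x,y,z,w\in\mathbb R^{n\times n}$ denote the blocks of $g=\begin{pmatrix} x& y\\ z& w\end{pmatrix}\in\mathrm{Sp}(n,\mathbb R)$.
   Context: Elements of $\mathbb C^n$ are row vectors, so $a^tv$ is the $n\times n$ matrix with entries $a_iv_j$. $\mathrm{Sp}(n,\mathbb R)=\{g\in\mathrm{SL}_{2n}(\mathbb R)\ |\ gJ_ng^t=J_n\}$ with $J_n=\begin{pmatrix}0&I_n\\-I_n&0\end{pmatrix}$. It carries its standard left-invariant Riemannian metric, induced by the scalar product $g(Z,W)=\mathrm{Re}\,\mathrm{trace}(ZW^* )$ on its Lie algebra. For complex valued functions $\phi,\psi$ on a Lie group with left-invariant Riemannian metric, the Laplacian (tension field) $\tau$ and the operator $\kappa(\phi,\psi)=g(\mathrm{grad}(\phi),\mathrm{grad}(\psi))$ ($g$ extended complex bilinearly) are given by $\tau(\phi)=\sum_{Z\in\mathcal B}Z^2(\phi)$ and $\kappa(\phi,\psi)=\sum_{Z\in\mathcal B}Z(\phi)Z(\psi)$, where $\mathcal B$ is any orthonormal basis of the Lie algebra of left-invariant vector fields, $Z(\phi)(p)=\frac{d}{ds}[\phi(p\cdot\exp(sZ))]|_{s=0}$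 and $Z^2(\phi)(p)=\frac{d^2}{ds^2}[\phi(p\cdot\exp(sZ))]|_{s=0}$. A set $\mathcal E$ of complex valued functions is an eigenfamily if there exist $\lambda,\mu\in\mathbb C$ with $\tau(\phi)=\lambda\phi$ and $\kappa(\phi,\psi)=\mu\phi\psi$ for all $\phi,\psi\in\mathcal E$. *)

theory Defs
  imports "HOL-Analysis.Analysis" "HOL-Library.Function_Algebras"
begin

text \<open>
  A \<open>2n \<times> 2n\<close> matrix is indexed by \<open>'n + 'n\<close> with \<open>n = CARD('n)\<close>; \<open>Inl\<close> marks the first
  \<open>n\<close> rows or columns and \<open>Inr\<close> the last \<open>n\<close>. Matrix multiplication is \<open>**\<close>; the library's
  \<open>*\<close> and \<open>^\<close> on \<open>real^'m^'m\<close> are componentwise, so its \<open>exp\<close> cannot be used for matrices.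
\<close>

definition block_matrix ::
  "'a^'n^'n \<Rightarrow> 'a^'n^'n \<Rightarrow> 'a^'n^'n \<Rightarrow> 'a^'n^'n \<Rightarrow> 'a^('n + 'n)^('n + 'n)" where
  "block_matrix x y z w = (\<chi> i j.
     case i of
       Inl k \<Rightarrow> (case j of Inl l \<Rightarrow> x $ k $ l | Inr l \<Rightarrow> y $ k $ l)
     | Inr k \<Rightarrow> (case j of Inl l \<Rightarrow> z $ k $ l | Inr l \<Rightarrow> w $ k $ l))"

definition J :: "real^('n::finite + 'n)^('n + 'n)" where
  "J = block_matrix (mat 0) (mat 1) (mat (- 1)) (mat 0)"

definition symplectic_group :: "(real^('n::finite + 'n)^('n + 'n)) set" where
  "symplectic_group = {g. det g = 1 \<and> g ** J ** transpose g = J}"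

text \<open>
  A type for the group, so that functions on it are not confused with functions on the ambient
  space of matrices; this matters for the dimension of a space of such functions.
\<close>

typedef (overloaded) ('n::finite) Sp = "symplectic_group :: (real^('n::finite + 'n)^('n + 'n)) set"
  by (rule exI[of _ "mat 1"]) (simp add: symplectic_group_def transpose_mat)

definition matrix_exp :: "real^'m^'m \<Rightarrow> real^'m^'m" where
  "matrix_exp Z = (\<Sum>k. (1 / fact k) *\<^sub>R (((**) Z) ^^ k) (mat 1))"

definition lie_algebra :: "(real^('n::finite + 'n)^('n + 'n)) set" where
  "lie_algebra = {Z. \<forall>s. matrix_exp (s *\<^sub>R Z) \<in> symplectic_group}"

text \<open>The scalar product \<open>Re trace(Z W\<^sup>*)\<close>; the matrices are real, so \<open>W\<^sup>* = W\<^sup>t\<close>.\<close>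

definition scalar_product :: "real^'m^'m \<Rightarrow> real^'m^'m \<Rightarrow> real" where
  "scalar_product Z W = trace (Z ** transpose W)"

text \<open>Independence and finiteness of \<open>B\<close> follow from orthonormality.\<close>

definition orthonormal_basis :: "(real^('n::finite + 'n)^('n + 'n)) set \<Rightarrow> bool" where
  "orthonormal_basis B \<longleftrightarrow>
     (\<forall>Z\<in>B. \<forall>W\<in>B. scalar_product Z W = (if Z = W then 1 else 0)) \<and> span B = lie_algebra"

definition translate :: "'n::finite Sp \<Rightarrow> real^('n::finite + 'n)^('n + 'n) \<Rightarrow> 'n Sp" where
  "translate p Z = Abs_Sp (Rep_Sp p ** matrix_exp Z)"

definition lie_deriv ::
  "real^('n::finite + 'n)^('n + 'n) \<Rightarrow> ('n::finite Sp \<Rightarrow> complex) \<Rightarrow> 'n Sp \<Rightarrow> complex" where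
  "lie_deriv Z \<phi> p = vector_derivative (\<lambda>s. \<phi> (translate p (s *\<^sub>R Z))) (at 0)"

definition lie_deriv2 ::
  "real^('n::finite + 'n)^('n + 'n) \<Rightarrow> ('n::finite Sp \<Rightarrow> complex) \<Rightarrow> 'n Sp \<Rightarrow> complex" where
  "lie_deriv2 Z \<phi> p =
     vector_derivative
       (\<lambda>s. vector_derivative (\<lambda>t. \<phi> (translate p (t *\<^sub>R Z))) (at s)) (at 0)"

text \<open>
  \<open>vector_derivative\<close> is total, so differentiability has to be required separately. A function
  on a Lie group is \<open>C\<^sup>k\<close> iff its iterated derivatives of order at most \<open>k\<close> along
  left-invariant vector fields exist and are continuous.
\<close>

primrec C_diff :: "nat \<Rightarrow> ('n::finite Sp \<Rightarrow> complex) \<Rightarrow> bool" where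
  "C_diff 0 \<phi> \<longleftrightarrow> continuous_on symplectic_group (\<lambda>g. \<phi> (Abs_Sp g))"
| "C_diff (Suc k) \<phi> \<longleftrightarrow>
     continuous_on symplectic_group (\<lambda>g. \<phi> (Abs_Sp g)) \<and>
     (\<forall>Z\<in>lie_algebra.
        (\<forall>p. (\<lambda>s::real. \<phi> (translate p (s *\<^sub>R Z))) differentiable (at 0)) \<and>
        C_diff k (lie_deriv Z \<phi>))"

definition smooth :: "('n::finite Sp \<Rightarrow> complex) \<Rightarrow> bool" where
  "smooth \<phi> \<longleftrightarrow> (\<forall>k. C_diff k \<phi>)"

definition tension ::
  "(real^('n::finite + 'n)^('n + 'n)) set \<Rightarrow> ('n::finite Sp \<Rightarrow> complex) \<Rightarrow> 'n Sp \<Rightarrow> complex" where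
  "tension B \<phi> p = (\<Sum>Z\<in>B. lie_deriv2 Z \<phi> p)"

definition conformality ::
  "(real^('n::finite + 'n)^('n + 'n)) set \<Rightarrow>
    ('n::finite Sp \<Rightarrow> complex) \<Rightarrow> ('n Sp \<Rightarrow> complex) \<Rightarrow> 'n Sp \<Rightarrow> complex" where
  "conformality B \<phi> \<psi> p = (\<Sum>Z\<in>B. lie_deriv Z \<phi> p * lie_deriv Z \<psi> p)"

text \<open>
  The operators do not depend on the orthonormal basis, and \<open>\<tau>\<close>, \<open>\<kappa>\<close> are given by any of them;
  accordingly the eigenvalues \<open>l\<close> (for \<open>\<tau>\<close>) and \<open>m\<close> (for \<open>\<kappa>\<close>) are chosen before \<open>B\<close>.
\<close>

definition eigenfamily :: "('n::finite Sp \<Rightarrow> complex) set \<Rightarrow> bool" where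
  "eigenfamily E \<longleftrightarrow>
     (\<forall>\<phi>\<in>E. smooth \<phi>) \<and>
     (\<exists>l m. \<forall>B. orthonormal_basis B \<longrightarrow>
        (\<forall>\<phi>\<in>E. \<forall>p. tension B \<phi> p = l * \<phi> p) \<and>
        (\<forall>\<phi>\<in>E. \<forall>\<psi>\<in>E. \<forall>p. conformality B \<phi> \<psi> p = m * \<phi> p * \<psi> p))"

definition outer :: "complex^'n \<Rightarrow> complex^'n \<Rightarrow> complex^'n^'n" where
  "outer a v = (\<chi> i j. a $ i * v $ j)"

definition complex_matrix :: "real^'n^'n \<Rightarrow> real^'n^'n \<Rightarrow> complex^'n^'n" where
  "complex_matrix x y = (\<chi> i j. of_real (x $ i $ j) + \<i> * of_real (y $ i $ j))"

definition block_x :: "'n::finite Sp \<Rightarrow> real^'n^'n" where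
  "block_x g = (\<chi> i j. Rep_Sp g $ Inl i $ Inl j)"

definition block_y :: "'n::finite Sp \<Rightarrow> real^'n^'n" where
  "block_y g = (\<chi> i j. Rep_Sp g $ Inl i $ Inr j)"

definition block_z :: "'n::finite Sp \<Rightarrow> real^'n^'n" where
  "block_z g = (\<chi> i j. Rep_Sp g $ Inr i $ Inl j)"

definition block_w :: "'n::finite Sp \<Rightarrow> real^'n^'n" where
  "block_w g = (\<chi> i j. Rep_Sp g $ Inr i $ Inr j)"

definition phi :: "complex^'n \<Rightarrow> complex^'n \<Rightarrow> complex^'n \<Rightarrow> 'n::finite Sp \<Rightarrow> complex" where
  "phi v a b g =
     trace (outer a v ** transpose (complex_matrix (block_x g) (block_y g)) +
            outer b v ** transpose (complex_matrix (block_z g) (block_w g)))"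

definition family :: "complex^'n \<Rightarrow> ('n::finite Sp \<Rightarrow> complex) set" where
  "family v = {phi v a b | a b. True}"

definition fun_scale :: "complex \<Rightarrow> ('a \<Rightarrow> complex) \<Rightarrow> 'a \<Rightarrow> complex" where
  "fun_scale c f = (\<lambda>x. c * f x)"

interpretation fun_space: vector_space fun_scale
  by unfold_locales (auto simp: fun_scale_def fun_eq_iff algebra_simps)

end

theory Submission
  imports Defs
begin

text \<open>
  Write \<open>c = (a, b)\<close> and \<open>u = (v, iv)\<close>, both in \<open>\<complex>\<^sup>2\<^sup>n\<close>. Then \<open>\<phi>\<^sub>a\<^sub>b(g) = c\<^sup>t g u\<close> is a matrix
  coefficient of the defining representation, and two properties of \<open>u\<close> do all the work:
  \<open>J u = iu\<close>, and, as a consequence, \<open>u\<^sup>t u = 0\<close>.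

  Left-invariant fields act on the second vector only: \<open>Z\<close> sends \<open>c\<^sup>t g u\<close> to \<open>c\<^sup>t g Z u\<close>, and
  \<open>Z\<^sup>2\<close> sends it to \<open>c\<^sup>t g Z Z u\<close>. Such functions are therefore smooth, and after replacing \<open>c\<^sup>t\<close> by
  \<open>c\<^sup>t g\<close> the operators \<open>\<tau>\<close> and \<open>\<kappa>\<close> become the sums \<open>\<Sum> c\<^sup>t Z Z u\<close> and
  \<open>\<Sum> (c\<^sup>t Z u) (d\<^sup>t Z u)\<close> over an orthonormal basis of the Lie algebra.

  The Lie algebra consists of the \<open>Z\<close> with \<open>Z J + J Z\<^sup>t = 0\<close>, that is, of the fixed points of the
  isometric involution \<open>Z \<mapsto> J Z\<^sup>t J\<close>. The orthogonal projection onto it is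
  \<open>P(E) = (E + J E\<^sup>t J) / 2\<close>, and \<open>P(E) = \<Sum> \<langle>E, Z\<rangle> Z\<close> for every orthonormal basis. Applied to the
  matrix units this gives (\<open>sum_basis_entry_mult_coeff\<close>)
  \<open>\<Sum> Z\<^sub>a\<^sub>b (c\<^sup>t Z u) = (c\<^sub>a u\<^sub>b + i (c\<^sup>t J)\<^sub>b u\<^sub>a) / 2\<close>.
  Contracting once more, the terms with \<open>u\<^sup>t u\<close> and with the diagonal of \<open>J\<close> vanish, and what is
  left is \<open>\<tau>(\<phi>) = \<phi> / 2\<close> (\<open>tension_sp_coeff\<close>) and \<open>\<kappa>(\<phi>, \<psi>) = - \<phi> \<psi> / 2\<close>
  (\<open>conformality_sp_coeff\<close>).

  For the dimension it has to be seen that \<open>c \<mapsto> c\<^sup>t g u\<close> is injective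
  (\<open>sp_coeff_eq_0_imp_eq_0\<close>). If the function is zero, its derivatives at the identity give
  \<open>c\<^sup>t Z u = 0\<close> on the Lie algebra, so \<open>c\<^sup>t P(E) u = 0\<close> for all \<open>E\<close>; this forces \<open>c = \<alpha>u\<close> with
  \<open>\<alpha> = - \<alpha>\<close>.
\<close>
section \<open>Matrix multiplication and the matrix exponential\<close>

lemma bounded_bilinear_matrix_mult:
  "bounded_bilinear ((**) :: real^'m^'m \<Rightarrow> real^'m^'m \<Rightarrow> real^'m^'m)"
proof -
  have "bilinear ((**) :: real^'m^'m \<Rightarrow> real^'m^'m \<Rightarrow> real^'m^'m)"
    unfolding bilinear_def
    by (auto intro!: linearI simp: matrix_matrix_mult_def vec_eq_iff algebra_simps
        sum.distrib sum_distrib_left)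
  then show ?thesis
    by (simp add: bilinear_conv_bounded_bilinear)
qed

interpretation matrix_mult:
  bounded_bilinear "(**) :: real^'m^'m \<Rightarrow> real^'m^'m \<Rightarrow> real^'m^'m"
  by (rule bounded_bilinear_matrix_mult)

lemma bounded_linear_transpose:
  "bounded_linear (transpose :: real^'m^'m \<Rightarrow> real^'m^'m)"
  by (auto intro!: linearI linear_conv_bounded_linear[THEN iffD1] simp: transpose_def vec_eq_iff)

lemma transpose_add: "transpose (A + B) = transpose A + transpose B"
  by (simp add: transpose_def vec_eq_iff)

lemma transpose_uminus: "transpose (- A) = - transpose A"
  by (simp add: transpose_def vec_eq_iff)

definition matrix_power :: "real^'m^'m \<Rightarrow> nat \<Rightarrow> real^'m^'m" where
  "matrix_power Z k = ((**) Z ^^ k) (mat 1)"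

lemma matrix_power_0 [simp]: "matrix_power Z 0 = mat 1"
  by (simp add: matrix_power_def)

text \<open>
  The powers are built by multiplication from the left; the new factor is needed on the right, so
  that the derivative of the exponential has the form of a left-invariant field.
\<close>
lemma matrix_power_Suc: "matrix_power Z (Suc k) = matrix_power Z k ** Z"
  by (induction k) (simp_all add: matrix_power_def matrix_mul_assoc)

lemma matrix_power_scaleR: "matrix_power (s *\<^sub>R Z) k = s ^ k *\<^sub>R matrix_power Z k"
  by (induction k)
    (simp_all add: matrix_power_Suc matrix_mult.scaleR_left matrix_mult.scaleR_right)

lemma summable_matrix_exp:
  fixes Z :: "real^'m^'m"
  shows "summable (\<lambda>k. (1 / fact k) *\<^sub>R matrix_power Z k)"
proof -
  obtain K where K: "K > 0" "\<And>A B. norm (A ** B :: real^'m^'m) \<le> norm A * norm (B :: real^'m^'m) * K"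
    using matrix_mult.pos_bounded by blast
  have power: "norm (matrix_power Z k) \<le> norm (mat 1 :: real^'m^'m) * (norm Z * K) ^ k" for k
  proof (induction k)
    case (Suc k)
    have "norm (matrix_power Z (Suc k)) \<le> norm (matrix_power Z k) * (norm Z * K)"
      using K(2)[of "matrix_power Z k" Z] by (simp add: matrix_power_Suc mult.assoc)
    also have "\<dots> \<le> (norm (mat 1 :: real^'m^'m) * (norm Z * K) ^ k) * (norm Z * K)"
      using Suc K(1) by (intro mult_right_mono) auto
    finally show ?case by (simp add: mult_ac)
  qed simp
  show ?thesis
  proof (rule summable_comparison_test')
    show "summable (\<lambda>k. norm (mat 1 :: real^'m^'m) * (inverse (fact k) * (norm Z * K) ^ k))"
      by (intro summable_mult summable_exp)
    show "norm ((1 / fact k) *\<^sub>R matrix_power Z k)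
        \<le> norm (mat 1 :: real^'m^'m) * (inverse (fact k) * (norm Z * K) ^ k)" for k
      using mult_left_mono[OF power[of k], of "inverse (fact k)"]
      by (simp add: divide_inverse mult_ac)
  qed
qed

lemma matrix_exp_series: "matrix_exp Z = (\<Sum>k. (1 / fact k) *\<^sub>R matrix_power Z k)"
  by (simp add: matrix_exp_def matrix_power_def)

lemma matrix_exp_zero [simp]: "matrix_exp (0 :: real^'m^'m) = mat 1"
proof -
  have "(1 / fact k) *\<^sub>R matrix_power (0 :: real^'m^'m) k = (if k = 0 then mat 1 else 0)" for k
    by (cases k) (simp_all add: matrix_power_Suc)
  then show ?thesis
    unfolding matrix_exp_series
    using suminf_finite[of "{0}" "\<lambda>k. if k = 0 then mat 1 else 0 :: real^'m^'m"] by simp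
qed

text \<open>
  Each component of \<open>s \<mapsto> exp(sZ)\<close> is an everywhere convergent real power series in \<open>s\<close>, which may
  be differentiated term by term.
\<close>
lemma matrix_exp_has_vector_derivative:
  "((\<lambda>s. matrix_exp (s *\<^sub>R Z)) has_vector_derivative matrix_exp (s *\<^sub>R Z) ** Z) (at s)"
proof -
  have component:
    "((\<lambda>s. matrix_exp (s *\<^sub>R Z) \<bullet> b) has_real_derivative (matrix_exp (s *\<^sub>R Z) ** Z) \<bullet> b) (at s)"
    for b
  proof -
    define c where "c k = (matrix_power Z k \<bullet> b) / fact k" for k
    have series: "(\<lambda>k. c k * t ^ k) sums (matrix_exp (t *\<^sub>R Z) \<bullet> b)" for t
    proof -
      have "(\<lambda>k. (1 / fact k) *\<^sub>R matrix_power (t *\<^sub>R Z) k) sums matrix_exp (t *\<^sub>R Z)"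
        unfolding matrix_exp_series by (rule summable_sums[OF summable_matrix_exp])
      from bounded_linear.sums[OF bounded_linear_inner_left[of b] this]
      show ?thesis by (simp add: c_def matrix_power_scaleR mult_ac)
    qed
    have "bounded_linear (\<lambda>M. (M ** Z) \<bullet> b)"
      by (rule bounded_linear_compose[OF bounded_linear_inner_left matrix_mult.bounded_linear_left])
    moreover have "(\<lambda>k. (1 / fact k) *\<^sub>R matrix_power (s *\<^sub>R Z) k) sums matrix_exp (s *\<^sub>R Z)"
      unfolding matrix_exp_series by (rule summable_sums[OF summable_matrix_exp])
    ultimately have "(\<lambda>k. (((1 / fact k) *\<^sub>R matrix_power (s *\<^sub>R Z) k) ** Z) \<bullet> b)
        sums ((matrix_exp (s *\<^sub>R Z) ** Z) \<bullet> b)"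
      by (rule bounded_linear.sums)
    moreover have "(((1 / fact k) *\<^sub>R matrix_power (s *\<^sub>R Z) k) ** Z) \<bullet> b = diffs c k * s ^ k" for k
      by (simp add: diffs_def c_def matrix_power_scaleR matrix_power_Suc
          matrix_mult.scaleR_left field_simps del: of_nat_Suc)
    ultimately have derivative: "(\<Sum>k. diffs c k * s ^ k) = (matrix_exp (s *\<^sub>R Z) ** Z) \<bullet> b"
      by (simp add: sums_iff)
    have "((\<lambda>s. \<Sum>k. c k * s ^ k) has_real_derivative (\<Sum>k. diffs c k * s ^ k)) (at s)"
      using series by (intro termdiffs_strong_converges_everywhere) (auto simp: sums_iff)
    then show ?thesis
      using series derivative by (simp add: sums_iff)
  qed
  show ?thesis
    unfolding has_vector_derivative_def
  proof (rule has_derivative_componentwise_within[THEN iffD2], intro ballI)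
    show "((\<lambda>s. matrix_exp (s *\<^sub>R Z) \<bullet> b) has_derivative
        (\<lambda>h. (h *\<^sub>R (matrix_exp (s *\<^sub>R Z) ** Z)) \<bullet> b)) (at s)" for b
      using component[of b, unfolded has_field_derivative_def]
      by (rule has_derivative_eq_rhs) (simp add: fun_eq_iff mult.commute)
  qed
qed

section \<open>The symplectic Lie algebra\<close>

lemma sum_UNIV_sum:
  fixes f :: "'a::finite + 'b::finite \<Rightarrow> 'c::comm_monoid_add"
  shows "(\<Sum>p\<in>UNIV. f p) = (\<Sum>k\<in>UNIV. f (Inl k)) + (\<Sum>k\<in>UNIV. f (Inr k))"
  unfolding UNIV_Plus_UNIV[symmetric] by (subst sum.Plus) auto

lemma J_nth [simp]:
  "J $ Inl k $ Inl l = 0" "J $ Inl k $ Inr l = (if k = l then 1 else 0)"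
  "J $ Inr k $ Inl l = (if k = l then - 1 else 0)" "J $ Inr k $ Inr l = 0"
  by (auto simp: J_def block_matrix_def mat_def)

lemma J_diagonal [simp]: "J $ p $ p = 0"
  by (cases p) auto

lemma transpose_J: "transpose J = - J"
proof -
  have "transpose J $ p $ q = (- J) $ p $ q" for p q :: "'a + 'a"
    by (cases p; cases q) (auto simp: transpose_def)
  then show ?thesis by (simp only: vec_eq_iff) simp
qed

text \<open>Stated for a real algebra, so that \<open>J\<close> can be applied to real and to complex vectors.\<close>
lemma sum_J_row:
  fixes f :: "'n::finite + 'n \<Rightarrow> 'a::real_algebra_1"
  shows "(\<Sum>q\<in>UNIV. of_real (J $ Inl k $ q) * f q) = f (Inr k)"
    and "(\<Sum>q\<in>UNIV. of_real (J $ Inr k $ q) * f q) = - f (Inl k)"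
proof -
  have "of_real (J $ Inl k $ Inr l) * f (Inr l) = (if l = k then f (Inr l) else 0)" for l
    by simp
  then show "(\<Sum>q\<in>UNIV. of_real (J $ Inl k $ q) * f q) = f (Inr k)"
    by (simp add: sum_UNIV_sum del: J_nth(2))
  have "of_real (J $ Inr k $ Inl l) * f (Inl l) = (if l = k then - f (Inl l) else 0)" for l
    by simp
  then show "(\<Sum>q\<in>UNIV. of_real (J $ Inr k $ q) * f q) = - f (Inl k)"
    by (simp add: sum_UNIV_sum del: J_nth(3))
qed

lemma J_squared: "J ** J = - mat 1"
proof -
  have "(J ** J) $ p $ q = (- mat 1) $ p $ q" for p q :: "'a + 'a"
    using sum_J_row[of _ "\<lambda>r. J $ r $ q"]
    by (cases p; cases q) (auto simp: matrix_matrix_mult_def mat_def)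
  then show ?thesis by (simp only: vec_eq_iff) simp
qed

lemma J_squared_left: "A ** J ** J = - A"
  for A :: "real^('n::finite + 'n)^('n + 'n)"
  by (simp add: matrix_mul_assoc[symmetric] J_squared matrix_mult.minus_right)

lemma det_eq_1_or_minus_1_if_preserves_J:
  fixes g :: "real^('n::finite + 'n)^('n + 'n)"
  assumes "g ** J ** transpose g = J"
  shows "det g = 1 \<or> det g = - 1"
proof -
  have "det g * det (J :: real^('n + 'n)^('n + 'n)) * det g = det (J :: real^('n + 'n)^('n + 'n))"
    using arg_cong[OF assms, of det] by (simp only: det_mul det_transpose)
  moreover have "det (J :: real^('n + 'n)^('n + 'n)) \<noteq> 0"
  proof -
    have "J ** (- J) = (mat 1 :: real^('n + 'n)^('n + 'n))"
      by (simp add: matrix_mult.minus_right J_squared)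
    then have "invertible (J :: real^('n + 'n)^('n + 'n))"
      using invertible_right_inverse by blast
    then show ?thesis by (simp add: invertible_det_nz)
  qed
  ultimately have "(det g)\<^sup>2 = 1"
    by (auto simp: power2_eq_square mult.commute[of _ "det J"] mult.assoc)
  then show ?thesis by (simp add: power2_eq_1_iff)
qed

text \<open>
  The derivative of \<open>exp(sZ) J exp(sZ)\<^sup>t\<close> contains \<open>Z J + J Z\<^sup>t\<close> as a factor. Read at \<open>s = 0\<close> this
  yields the linear equation of the Lie algebra; read at all \<open>s\<close>, that equation makes the form
  constant.
\<close>
lemma preserved_form_has_vector_derivative:
  "((\<lambda>s. matrix_exp (s *\<^sub>R Z) ** J ** transpose (matrix_exp (s *\<^sub>R Z))) has_vector_derivative
      matrix_exp (s *\<^sub>R Z) ** (Z ** J + J ** transpose Z) ** transpose (matrix_exp (s *\<^sub>R Z))) (at s)"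
proof -
  have 1: "((\<lambda>s. matrix_exp (s *\<^sub>R Z) ** J) has_vector_derivative
      matrix_exp (s *\<^sub>R Z) ** Z ** J) (at s)"
    by (rule bounded_linear.has_vector_derivative[OF matrix_mult.bounded_linear_left
        matrix_exp_has_vector_derivative])
  have 2: "((\<lambda>s. transpose (matrix_exp (s *\<^sub>R Z))) has_vector_derivative
      transpose (matrix_exp (s *\<^sub>R Z) ** Z)) (at s)"
    by (rule bounded_linear.has_vector_derivative[OF bounded_linear_transpose
        matrix_exp_has_vector_derivative])
  show ?thesis
    using matrix_mult.has_vector_derivative[OF 1 2]
    by (simp add: matrix_transpose_mul matrix_mul_assoc matrix_add_ldistrib
        matrix_mult.add_left add.commute)
qed

text \<open>
  Preservation of \<open>J\<close> yields the determinant only up to sign; the sign is \<open>+\<close> by continuity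
  along the one-parameter group.
\<close>
lemma matrix_exp_in_symplectic_group:
  assumes Z: "Z ** J + J ** transpose Z = 0"
  shows "matrix_exp (s *\<^sub>R Z) \<in> symplectic_group"
proof -
  define E where "E s = matrix_exp (s *\<^sub>R Z)" for s
  have form: "E s ** J ** transpose (E s) = J" for s
  proof -
    have "E s ** J ** transpose (E s) = E 0 ** J ** transpose (E 0)"
    proof (rule has_derivative_zero_unique[of UNIV "\<lambda>s. E s ** J ** transpose (E s)" s 0])
      show "((\<lambda>s. E s ** J ** transpose (E s)) has_derivative (\<lambda>h. 0)) (at t within UNIV)" for t
        using preserved_form_has_vector_derivative[of Z t, unfolded Z has_vector_derivative_def]
        by (simp add: E_def)
    qed auto
    then show ?thesis by (simp add: E_def)
  qed
  have "range (\<lambda>s. det (E s)) \<subseteq> {1, - 1}"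
    using det_eq_1_or_minus_1_if_preserves_J[OF form] by (intro image_subsetI) simp
  then have "finite (range (\<lambda>s. det (E s)))"
    by (rule finite_subset) simp
  moreover have "continuous_on UNIV (\<lambda>s. det (E s))"
  proof -
    have "continuous_on UNIV E"
      unfolding E_def
      by (intro continuous_at_imp_continuous_on ballI
          has_vector_derivative_continuous[OF matrix_exp_has_vector_derivative])
    then show ?thesis
      unfolding det_def by (intro continuous_intros)
  qed
  ultimately have "(\<lambda>s. det (E s)) constant_on UNIV"
    by (intro continuous_finite_range_constant) auto
  then have "det (E s) = det (E 0)"
    by (auto simp: constant_on_def)
  then show ?thesis
    using form by (simp add: symplectic_group_def E_def)
qed

lemma lie_algebra_iff: "Z \<in> lie_algebra \<longleftrightarrow> Z ** J + J ** transpose Z = 0"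
proof
  assume "Z \<in> lie_algebra"
  then have "(\<lambda>s. matrix_exp (s *\<^sub>R Z) ** J ** transpose (matrix_exp (s *\<^sub>R Z))) = (\<lambda>s. J)"
    by (auto simp: lie_algebra_def symplectic_group_def)
  then have "((\<lambda>s. J) has_vector_derivative (Z ** J + J ** transpose Z)) (at 0)"
    using preserved_form_has_vector_derivative[of Z 0] by simp
  from vector_derivative_unique_at[OF this has_vector_derivative_const]
  show "Z ** J + J ** transpose Z = 0" .
qed (simp add: lie_algebra_def matrix_exp_in_symplectic_group)

lemma lie_algebra_involution:
  assumes "Z \<in> lie_algebra"
  shows "J ** transpose Z ** J = Z"
proof -
  have "(Z ** J + J ** transpose Z) ** J = 0"
    using assms by (simp add: lie_algebra_iff)
  then show ?thesis
    by (simp add: matrix_mult.add_left J_squared_left)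
qed

text \<open>The orthogonal projection onto the fixed space of \<open>Z \<mapsto> J Z\<^sup>t J\<close>.\<close>
definition lie_projection ::
  "real^('n::finite + 'n)^('n + 'n) \<Rightarrow> real^('n + 'n)^('n + 'n)" where
  "lie_projection E = (1 / 2) *\<^sub>R (E + J ** transpose E ** J)"

lemma lie_projection_in_lie_algebra: "lie_projection E \<in> lie_algebra"
  by (simp add: lie_projection_def lie_algebra_iff transpose_scalar transpose_add transpose_uminus
      matrix_transpose_mul transpose_J matrix_mult.scaleR_left matrix_mult.scaleR_right
      matrix_mult.add_left matrix_add_ldistrib matrix_mult.minus_left matrix_mult.minus_right
      matrix_mul_assoc J_squared_left J_squared scaleR_diff_right)

lemma inner_matrix_eq_trace: "A \<bullet> B = trace (A ** transpose B)"
  for A B :: "real^'m^'m"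
  by (simp add: inner_vec_def trace_def matrix_matrix_mult_def transpose_def)

text \<open>
  By cyclicity of the trace the involution is self-adjoint, and it fixes \<open>Z\<close>; hence both halves
  of the projection have the same scalar product with \<open>Z\<close>.
\<close>
lemma inner_lie_projection:
  assumes "Z \<in> lie_algebra"
  shows "lie_projection E \<bullet> Z = E \<bullet> Z"
proof -
  have "(J ** transpose E ** J) \<bullet> Z = trace (J ** (transpose E ** J ** transpose Z))"
    by (simp add: inner_matrix_eq_trace matrix_mul_assoc)
  also have "\<dots> = trace (transpose E ** (J ** transpose Z ** J))"
    by (subst trace_mul_sym) (simp only: matrix_mul_assoc)
  also have "\<dots> = trace (Z ** transpose E)"
    unfolding lie_algebra_involution[OF assms] by (rule trace_mul_sym)
  also have "\<dots> = E \<bullet> Z"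
    by (simp add: inner_matrix_eq_trace[symmetric] inner_commute)
  finally show ?thesis
    by (simp add: lie_projection_def inner_add_left)
qed

lemma lie_projection_expand:
  assumes B: "orthonormal_basis B"
  shows "(\<Sum>Z\<in>B. (E \<bullet> Z) *\<^sub>R Z) = lie_projection E"
proof -
  have inner: "Z \<bullet> W = (if Z = W then 1 else 0)" if "Z \<in> B" "W \<in> B" for Z W
    using B that by (auto simp: orthonormal_basis_def scalar_product_def inner_matrix_eq_trace)
  have span: "span B = lie_algebra"
    using B by (simp add: orthonormal_basis_def)
  have orthogonal: "pairwise orthogonal B"
    by (auto simp: pairwise_def orthogonal_def inner)
  moreover have "0 \<notin> B"
    using inner[of 0 0] by auto
  ultimately have finite: "finite B"
    using pairwise_orthogonal_independent independent_imp_finite by blast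
  have "(\<Sum>Z\<in>B. (E \<bullet> Z) *\<^sub>R Z) = (\<Sum>Z\<in>B. (lie_projection E \<bullet> Z) *\<^sub>R Z)"
    using span_superset[of B] by (intro sum.cong) (auto simp: inner_lie_projection span)
  also have "\<dots> = lie_projection E"
    using orthogonal finite
    by (intro orthonormal_basis_expand)
      (auto simp: inner norm_eq_1 span lie_projection_in_lie_algebra)
  finally show ?thesis .
qed

section \<open>Matrix coefficients of the symplectic group\<close>

definition left_mult :: "real^'m^'m \<Rightarrow> complex^'m \<Rightarrow> complex^'m" where
  "left_mult M u = (\<chi> p. \<Sum>q\<in>UNIV. of_real (M $ p $ q) * u $ q)"

definition right_mult :: "complex^'m \<Rightarrow> real^'m^'m \<Rightarrow> complex^'m" where
  "right_mult c M = (\<chi> q. \<Sum>p\<in>UNIV. c $ p * of_real (M $ p $ q))"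

text \<open>The number \<open>c\<^sup>t M u\<close>, with \<open>M\<close> last because it is the variable of interest.\<close>
definition coeff :: "complex^'m \<Rightarrow> complex^'m \<Rightarrow> real^'m^'m \<Rightarrow> complex" where
  "coeff c u M = (\<Sum>p\<in>UNIV. \<Sum>q\<in>UNIV. c $ p * of_real (M $ p $ q) * u $ q)"

lemma coeff_eq_sum_left_mult: "coeff c u M = (\<Sum>p\<in>UNIV. c $ p * left_mult M u $ p)"
  by (simp add: coeff_def left_mult_def sum_distrib_left mult.assoc)

lemma coeff_eq_sum_right_mult: "coeff c u M = (\<Sum>q\<in>UNIV. right_mult c M $ q * u $ q)"
  unfolding coeff_def right_mult_def
  by (subst sum.swap) (simp add: sum_distrib_right)

lemma bounded_linear_coeff: "bounded_linear (coeff c u)"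
  by (rule linear_conv_bounded_linear[THEN iffD1], rule linearI)
    (simp_all add: coeff_def algebra_simps sum.distrib scaleR_conv_of_real[where 'a=complex]
      sum_distrib_left)

lemma left_mult_mult: "left_mult (M ** Z) u = left_mult M (left_mult Z u)"
proof -
  have "(\<Sum>q\<in>UNIV. of_real (\<Sum>r\<in>UNIV. M $ p $ r * Z $ r $ q) * u $ q) =
      (\<Sum>r\<in>UNIV. of_real (M $ p $ r) * (\<Sum>q\<in>UNIV. of_real (Z $ r $ q) * u $ q))" for p
    by (simp add: sum_distrib_left sum_distrib_right mult.assoc) (rule sum.swap)
  then show ?thesis
    by (simp add: left_mult_def matrix_matrix_mult_def vec_eq_iff)
qed

lemma coeff_mult_eq_left: "coeff c u (M ** Z) = coeff c (left_mult Z u) M"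
  by (simp add: coeff_eq_sum_left_mult left_mult_mult)

lemma coeff_mult_eq_right: "coeff c u (M ** Z) = coeff (right_mult c M) u Z"
  by (simp add: coeff_mult_eq_left coeff_eq_sum_right_mult[of _ _ M] coeff_eq_sum_left_mult[of _ _ Z])

lemma coeff_right_mult_mat_1: "coeff (right_mult c M) u (mat 1) = coeff c u M"
  using coeff_mult_eq_right[of c u M "mat 1"] by simp

lemma coeff_mat_1: "coeff c u (mat 1) = (\<Sum>p\<in>UNIV. c $ p * u $ p)"
proof -
  have "left_mult (mat 1) u = u"
    by (simp add: left_mult_def mat_def vec_eq_iff if_distrib[of of_real]
        if_distrib[of "\<lambda>x. x * _"] cong: if_cong)
  then show ?thesis by (simp add: coeff_eq_sum_left_mult)
qed

lemma coeff_axis: "coeff c u (axis a (axis b 1)) = c $ a * u $ b"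
proof -
  have "c $ p * of_real (axis a (axis b 1) $ p $ q) * u $ q =
      (if q = b then if p = a then c $ a * u $ b else 0 else 0)" for p q
    by (simp add: axis_def)
  then show ?thesis by (simp add: coeff_def)
qed

lemma left_mult_eq_coeff: "left_mult M u $ b = coeff (axis b 1) u M"
  by (simp add: coeff_eq_sum_left_mult axis_def if_distrib[of "\<lambda>x. x * _"] cong: if_cong)

definition sp_coeff :: "complex^('n + 'n) \<Rightarrow> complex^('n + 'n) \<Rightarrow> 'n::finite Sp \<Rightarrow> complex" where
  "sp_coeff c u p = coeff c u (Rep_Sp p)"

text \<open>
  The translate is defined through the abstraction function of the group type, so the product has
  to be shown symplectic before it can be computed with.
\<close>
lemma Rep_Sp_translate:
  assumes "Z \<in> lie_algebra"
  shows "Rep_Sp (translate p (s *\<^sub>R Z)) = Rep_Sp p ** matrix_exp (s *\<^sub>R Z)"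
proof -
  define g h where "g = Rep_Sp p" and "h = matrix_exp (s *\<^sub>R Z)"
  have g: "det g = 1" "g ** J ** transpose g = J"
    using Rep_Sp[of p] by (simp_all add: symplectic_group_def g_def)
  have h: "det h = 1" "h ** J ** transpose h = J"
    using assms by (auto simp: lie_algebra_def symplectic_group_def h_def)
  have "(g ** h) ** J ** transpose (g ** h) = g ** (h ** J ** transpose h) ** transpose g"
    by (simp only: matrix_transpose_mul matrix_mul_assoc)
  then have "g ** h \<in> symplectic_group"
    by (simp add: symplectic_group_def det_mul g h)
  then show ?thesis
    by (simp add: translate_def Abs_Sp_inverse g_def h_def)
qed

text \<open>
  Differentiation along \<open>Z\<close> turns the coefficient for \<open>u\<close> into the one for \<open>Zu\<close>. The class of
  coefficients is thus closed under all left-invariant fields, which reduces smoothness to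
  continuity and first-order differentiability.
\<close>
lemma sp_coeff_translate_has_vector_derivative:
  assumes "Z \<in> lie_algebra"
  shows "((\<lambda>s. sp_coeff c u (translate p (s *\<^sub>R Z))) has_vector_derivative
    sp_coeff c (left_mult Z u) (translate p (s *\<^sub>R Z))) (at s)"
proof -
  have "bounded_linear (\<lambda>M. coeff c u (Rep_Sp p ** M))"
    by (rule bounded_linear_compose[OF bounded_linear_coeff matrix_mult.bounded_linear_right])
  from bounded_linear.has_vector_derivative[OF this matrix_exp_has_vector_derivative]
  show ?thesis
    by (simp add: sp_coeff_def Rep_Sp_translate[OF assms] matrix_mul_assoc coeff_mult_eq_left)
qed

lemma translate_zero [simp]: "translate p 0 = p"
  by (simp add: translate_def Rep_Sp_inverse)

lemma lie_deriv_sp_coeff: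
  assumes "Z \<in> lie_algebra"
  shows "lie_deriv Z (sp_coeff c u) = sp_coeff c (left_mult Z u)"
  using vector_derivative_at[OF sp_coeff_translate_has_vector_derivative[OF assms, of c u _ 0]]
  by (auto simp: lie_deriv_def fun_eq_iff)

lemma lie_deriv2_sp_coeff:
  assumes "Z \<in> lie_algebra"
  shows "lie_deriv2 Z (sp_coeff c u) = sp_coeff c (left_mult (Z ** Z) u)"
proof
  fix p
  have "lie_deriv2 Z (sp_coeff c u) p = lie_deriv Z (sp_coeff c (left_mult Z u)) p"
    unfolding lie_deriv2_def lie_deriv_def
    by (simp only: vector_derivative_at[OF sp_coeff_translate_has_vector_derivative[OF assms]])
  then show "lie_deriv2 Z (sp_coeff c u) p = sp_coeff c (left_mult (Z ** Z) u) p"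
    by (simp add: lie_deriv_sp_coeff[OF assms] left_mult_mult)
qed

lemma smooth_sp_coeff: "smooth (sp_coeff c u)"
proof -
  have "continuous_on symplectic_group (\<lambda>g. sp_coeff c u (Abs_Sp g))" for u
  proof -
    have "continuous_on symplectic_group (coeff c u)"
      by (intro linear_continuous_on bounded_linear_coeff)
    then show ?thesis
      by (rule continuous_on_eq) (simp add: sp_coeff_def Abs_Sp_inverse)
  qed
  moreover have "(\<lambda>s. sp_coeff c u (translate p (s *\<^sub>R Z))) differentiable (at 0)"
    if "Z \<in> lie_algebra" for Z u p
    using sp_coeff_translate_has_vector_derivative[OF that] by (rule differentiableI_vector)
  ultimately have "C_diff k (sp_coeff c u)" for k
    by (induction k arbitrary: u) (auto simp: lie_deriv_sp_coeff)
  then show ?thesis by (simp add: smooth_def)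
qed

section \<open>Tension field and conformality operator of the coefficients\<close>

context
  fixes u :: "complex^('n::finite + 'n)"
  assumes J_eigenvector: "left_mult J u = \<i> *s u"
begin

text \<open>\<open>J u = iu\<close> means that the lower half of \<open>u\<close> is \<open>i\<close> times the upper half, so the squares cancel.\<close>
lemma isotropic: "(\<Sum>p\<in>UNIV. u $ p * u $ p) = 0"
proof -
  have "u $ Inr k = \<i> * u $ Inl k" for k
    using arg_cong[OF J_eigenvector, of "\<lambda>x. x $ Inl k"] sum_J_row(1)[of k "\<lambda>q. u $ q"]
    by (simp add: left_mult_def)
  then show ?thesis
    by (simp add: sum_UNIV_sum algebra_simps sum.distrib[symmetric])
qed

lemma coeff_lie_projection_axis:
  "coeff c u (lie_projection (axis a (axis b 1))) =
     (c $ a * u $ b + \<i> * right_mult c J $ b * u $ a) / 2"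
proof -
  have "transpose (axis a (axis b 1)) = (axis b (axis a 1) :: real^('n + 'n)^('n + 'n))"
    by (auto simp: transpose_def axis_def vec_eq_iff)
  then have "coeff c u (J ** transpose (axis a (axis b 1)) ** J) =
      right_mult c J $ b * (\<i> * u $ a)"
    by (simp only: coeff_mult_eq_left[of c u "J ** _" J] coeff_mult_eq_right[of c _ J]
        J_eigenvector coeff_axis vector_smult_component)
  then show ?thesis
    by (simp add: lie_projection_def linear_simps[OF bounded_linear_coeff] coeff_axis
        scaleR_conv_of_real[where 'a=complex])
qed

text \<open>
  Since \<open>Z\<^sub>a\<^sub>b\<close> is the scalar product of \<open>Z\<close> with a matrix unit \<open>E\<close>, the sum is the value of
  \<open>M \<mapsto> c\<^sup>t M u\<close> at the basis expansion of the projection of \<open>E\<close>. The right-hand side does not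
  mention the basis, so neither will the eigenvalues.
\<close>
lemma sum_basis_entry_mult_coeff:
  assumes "orthonormal_basis B"
  shows "(\<Sum>Z\<in>B. of_real (Z $ a $ b) * coeff c u Z) =
     (c $ a * u $ b + \<i> * right_mult c J $ b * u $ a) / 2"
proof -
  have "coeff c u (\<Sum>Z\<in>B. (axis a (axis b 1) \<bullet> Z) *\<^sub>R Z) =
      (\<Sum>Z\<in>B. of_real (Z $ a $ b) * coeff c u Z)"
    by (simp add: linear_sum[OF bounded_linear.linear[OF bounded_linear_coeff]]
        linear_simps[OF bounded_linear_coeff] inner_axis' scaleR_conv_of_real[where 'a=complex])
  then show ?thesis
    by (simp add: lie_projection_expand[OF assms] coeff_lie_projection_axis)
qed

text \<open>
  Expanding the first factor in entries of \<open>Z\<close> leaves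
  \<open>((c\<^sup>t d) (u\<^sup>t u) + i (c\<^sup>t u) (d\<^sup>t J u)) / 2\<close>. The first term is zero by isotropy, and
  \<open>d\<^sup>t J u = i d\<^sup>t u\<close> turns the second into \<open>- (c\<^sup>t u) (d\<^sup>t u) / 2\<close>.
\<close>
lemma sum_basis_coeff_mult_coeff:
  assumes B: "orthonormal_basis B"
  shows "(\<Sum>Z\<in>B. coeff c u Z * coeff d u Z) = - (1 / 2) * coeff c u (mat 1) * coeff d u (mat 1)"
proof -
  have "(\<Sum>Z\<in>B. coeff c u Z * coeff d u Z) =
      (\<Sum>a\<in>UNIV. \<Sum>b\<in>UNIV. c $ a * u $ b * (\<Sum>Z\<in>B. of_real (Z $ a $ b) * coeff d u Z))"
    unfolding coeff_def[of c] sum_distrib_right sum_distrib_left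
    by (subst sum.swap, rule sum.cong[OF refl], subst sum.swap) (simp add: mult_ac)
  also have "\<dots> = (\<Sum>a\<in>UNIV. \<Sum>b\<in>UNIV. ((c $ a * d $ a) * (u $ b * u $ b)
      + \<i> * ((c $ a * u $ a) * (right_mult d J $ b * u $ b))) / 2)"
    unfolding sum_basis_entry_mult_coeff[OF B] by (simp add: algebra_simps)
  also have "\<dots> = ((\<Sum>a\<in>UNIV. c $ a * d $ a) * (\<Sum>b\<in>UNIV. u $ b * u $ b)
      + \<i> * ((\<Sum>a\<in>UNIV. c $ a * u $ a) * (\<Sum>b\<in>UNIV. right_mult d J $ b * u $ b))) / 2"
    unfolding sum_product
    by (simp only: sum_distrib_left sum.distrib[symmetric] sum_divide_distrib)
  also have "(\<Sum>b\<in>UNIV. right_mult d J $ b * u $ b) = \<i> * (\<Sum>a\<in>UNIV. d $ a * u $ a)"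
    unfolding coeff_eq_sum_right_mult[symmetric] coeff_eq_sum_left_mult J_eigenvector
    by (simp add: sum_distrib_left mult_ac)
  finally show ?thesis
    by (simp add: isotropic coeff_mat_1 mult_ac)
qed

text \<open>
  Here the entries of the first factor \<open>Z\<close> are paired with the components of \<open>Zu\<close>, which are
  coefficients for unit vectors \<open>e\<^sub>b\<close>. The second term of the entry formula then contains
  \<open>(e\<^sub>b\<^sup>t J)\<^sub>b = J\<^sub>b\<^sub>b = 0\<close>, and only the diagonal \<open>a = b\<close> of the first one contributes.
\<close>
lemma sum_basis_coeff_square:
  assumes B: "orthonormal_basis B"
  shows "(\<Sum>Z\<in>B. coeff c u (Z ** Z)) = (1 / 2) * coeff c u (mat 1)"
proof -
  have "(\<Sum>Z\<in>B. coeff c u (Z ** Z)) = (\<Sum>a\<in>UNIV. \<Sum>b\<in>UNIV. c $ a *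
      (\<Sum>Z\<in>B. of_real (Z $ a $ b) * coeff (axis b 1) u Z))"
    unfolding coeff_mult_eq_left coeff_def[of c] left_mult_eq_coeff sum_distrib_left
    by (subst sum.swap, rule sum.cong[OF refl], subst sum.swap) (simp add: mult_ac)
  also have "\<dots> = (\<Sum>a\<in>UNIV. \<Sum>b\<in>UNIV. if b = a then c $ a * u $ a / 2 else 0)"
  proof (intro sum.cong refl)
    fix a b :: "'n + 'n"
    have "right_mult (axis b 1) J $ b = 0"
      by (simp add: right_mult_def axis_def if_distrib[of "\<lambda>x. x * _"] cong: if_cong)
    then show "c $ a * (\<Sum>Z\<in>B. of_real (Z $ a $ b) * coeff (axis b 1) u Z) =
        (if b = a then c $ a * u $ a / 2 else 0)"
      by (simp add: sum_basis_entry_mult_coeff[OF B] axis_def)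
  qed
  finally show ?thesis
    by (simp add: coeff_mat_1 sum_divide_distrib)
qed

lemma tension_sp_coeff:
  assumes B: "orthonormal_basis B"
  shows "tension B (sp_coeff c u) p = (1 / 2) * sp_coeff c u p"
proof -
  have "B \<subseteq> lie_algebra"
    using B span_superset[of B] by (auto simp: orthonormal_basis_def)
  then have "tension B (sp_coeff c u) p = (\<Sum>Z\<in>B. coeff (right_mult c (Rep_Sp p)) u (Z ** Z))"
    unfolding tension_def
    by (intro sum.cong refl)
      (auto simp: lie_deriv2_sp_coeff sp_coeff_def coeff_mult_eq_left[symmetric] coeff_mult_eq_right)
  also have "\<dots> = (1 / 2) * coeff c u (Rep_Sp p)"
    by (simp add: sum_basis_coeff_square[OF B] coeff_right_mult_mat_1)
  finally show ?thesis by (simp add: sp_coeff_def)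
qed

lemma conformality_sp_coeff:
  assumes B: "orthonormal_basis B"
  shows "conformality B (sp_coeff c u) (sp_coeff d u) p =
    - (1 / 2) * sp_coeff c u p * sp_coeff d u p"
proof -
  have "B \<subseteq> lie_algebra"
    using B span_superset[of B] by (auto simp: orthonormal_basis_def)
  then have "conformality B (sp_coeff c u) (sp_coeff d u) p =
      (\<Sum>Z\<in>B. coeff (right_mult c (Rep_Sp p)) u Z * coeff (right_mult d (Rep_Sp p)) u Z)"
    unfolding conformality_def
    by (intro sum.cong refl)
      (auto simp: lie_deriv_sp_coeff sp_coeff_def coeff_mult_eq_left[symmetric] coeff_mult_eq_right)
  also have "\<dots> = - (1 / 2) * coeff c u (Rep_Sp p) * coeff d u (Rep_Sp p)"
    by (simp add: sum_basis_coeff_mult_coeff[OF B] coeff_right_mult_mat_1)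
  finally show ?thesis by (simp add: sp_coeff_def)
qed

text \<open>
  Differentiation at the identity replaces the group by its Lie algebra, where the projected
  matrix units give equations \<open>c\<^sub>a u\<^sub>b + i d\<^sub>b u\<^sub>a = 0\<close> with \<open>d\<^sup>t = c\<^sup>t J\<close>. They make \<open>c\<close> a multiple
  \<open>\<alpha>u\<close> of \<open>u\<close>; then \<open>d = - i\<alpha>u\<close>, and substituting this back gives \<open>\<alpha> = - \<alpha>\<close>.
\<close>
lemma sp_coeff_eq_0_imp_eq_0:
  assumes "u \<noteq> 0" and zero: "\<And>p. sp_coeff c u p = 0"
  shows "c = 0"
proof -
  define d where "d = right_mult c J"
  have tangent: "coeff c u Z = 0" if "Z \<in> lie_algebra" for Z
  proof -
    have "mat 1 \<in> (symplectic_group :: (real^('n + 'n)^('n + 'n)) set)"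
      by (simp add: symplectic_group_def)
    then have "coeff c u Z = lie_deriv Z (sp_coeff c u) (Abs_Sp (mat 1))"
      by (simp add: lie_deriv_sp_coeff[OF that] sp_coeff_def Abs_Sp_inverse
          coeff_mult_eq_left[symmetric])
    also have "\<dots> = 0"
      by (simp add: lie_deriv_def zero)
    finally show ?thesis .
  qed
  have rel: "c $ a * u $ b + \<i> * d $ b * u $ a = 0" for a b
    using tangent[OF lie_projection_in_lie_algebra[of "axis a (axis b 1)"]]
    by (simp add: coeff_lie_projection_axis d_def)
  obtain q where q: "u $ q \<noteq> 0"
    using \<open>u \<noteq> 0\<close> by (auto simp: vec_eq_iff)
  \<comment> \<open>the factor obtained from the equations with \<open>b = q\<close>\<close>
  define \<alpha> where "\<alpha> = - \<i> * d $ q / u $ q"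
  have c: "c $ a = \<alpha> * u $ a" for a
    using rel[of a q] q by (simp add: \<alpha>_def field_simps eq_neg_iff_add_eq_0)
  have "d $ q = \<alpha> * (\<Sum>p\<in>UNIV. u $ p * of_real (J $ p $ q))"
    by (simp add: d_def right_mult_def c sum_distrib_left mult.assoc)
  also have "(\<Sum>p\<in>UNIV. u $ p * of_real (J $ p $ q)) = - (left_mult J u $ q)"
  proof -
    have "of_real (J $ p $ q) = (- of_real (J $ q $ p) :: complex)" for p
      using arg_cong[OF transpose_J, of "\<lambda>M. complex_of_real (M $ q $ p)"]
      by (simp add: transpose_def)
    then have "u $ p * of_real (J $ p $ q) = - (of_real (J $ q $ p) * u $ p)" for p
      by simp
    then show ?thesis
      by (simp only: left_mult_def sum_negf vec_lambda_beta)
  qed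
  finally have "d $ q = - \<i> * \<alpha> * u $ q"
    by (simp add: J_eigenvector)
  then have "\<alpha> = - \<alpha>"
    using q by (simp add: \<alpha>_def)
  then have "\<alpha> = 0" by simp
  then show ?thesis
    by (simp add: c vec_eq_iff)
qed

end

section \<open>The eigenfamily\<close>

definition join :: "complex^'n \<Rightarrow> complex^'n \<Rightarrow> complex^('n::finite + 'n)" where
  "join a b = (\<chi> p. case p of Inl k \<Rightarrow> a $ k | Inr k \<Rightarrow> b $ k)"

lemma join_nth [simp]: "join a b $ Inl k = a $ k" "join a b $ Inr k = b $ k"
  by (simp_all add: join_def)

lemma phi_eq_sp_coeff: "phi v a b = sp_coeff (join a b) (join v (\<i> *s v))"
  by (simp add: fun_eq_iff phi_def trace_def outer_def matrix_matrix_mult_def transpose_def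
      complex_matrix_def block_x_def block_y_def block_z_def block_w_def sp_coeff_def coeff_def
      sum_UNIV_sum algebra_simps sum.distrib)

lemma family_eq_range:
  fixes v :: "complex^'n::finite"
  shows "family v = range (\<lambda>c. sp_coeff c (join v (\<i> *s v)))"
proof -
  have join_surj: "c = join (\<chi> k. c $ Inl k) (\<chi> k. c $ Inr k)" for c :: "complex^('n + 'n)"
  proof (rule vec_eq_iff[THEN iffD2], rule allI)
    show "c $ p = join (\<chi> k. c $ Inl k) (\<chi> k. c $ Inr k) $ p" for p
      by (cases p) auto
  qed
  have "sp_coeff c (join v (\<i> *s v)) \<in> family v" for c
  proof -
    have "sp_coeff c (join v (\<i> *s v)) = phi v (\<chi> k. c $ Inl k) (\<chi> k. c $ Inr k)"
      unfolding phi_eq_sp_coeff by (rule arg_cong[OF join_surj])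
    then show ?thesis
      unfolding family_def by blast
  qed
  then show ?thesis
    by (auto simp: family_def phi_eq_sp_coeff)
qed

text \<open>
  This is where the combinations \<open>x + iy\<close> and \<open>z + iw\<close> of the blocks enter: they amount to the
  choice of an eigenvector of \<open>J\<close>.
\<close>
lemma J_eigenvector_join: "left_mult J (join v (\<i> *s v)) = \<i> *s join v (\<i> *s v)"
proof -
  have "left_mult J (join v (\<i> *s v)) $ p = (\<i> *s join v (\<i> *s v)) $ p" for p
    by (cases p) (simp_all add: left_mult_def sum_J_row)
  then show ?thesis by (simp only: vec_eq_iff) simp
qed

lemma linear_sp_coeff: "Vector_Spaces.linear (*s) fun_scale (\<lambda>c. sp_coeff c u)"
  by unfold_locales
    (auto simp: fun_eq_iff sp_coeff_def coeff_def fun_scale_def algebra_simps sum.distrib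
      sum_distrib_left)

theorem theorem6p2:
  fixes v :: "complex^'n"
  assumes "v \<noteq> 0"
  shows "fun_space.subspace (family v) \<and>
         fun_space.dim (family v) = 2 * CARD('n) \<and>
         eigenfamily (family v)"
proof -
  define u where "u = join v (\<i> *s v)"
  have J_u: "left_mult J u = \<i> *s u"
    by (simp add: u_def J_eigenvector_join)
  obtain k where "v $ k \<noteq> 0"
    using assms by (auto simp: vec_eq_iff)
  then have "u $ Inl k \<noteq> 0"
    by (simp add: u_def)
  then have "u \<noteq> 0"
    by auto
  interpret coeff_map: Vector_Spaces.linear "(*s)" fun_scale "\<lambda>c. sp_coeff c u"
    by (rule linear_sp_coeff)
  interpret pair: finite_dimensional_vector_space_pair_1
    "(*s) :: complex \<Rightarrow> complex^('n + 'n) \<Rightarrow> _" cart_basis "fun_scale :: complex \<Rightarrow> ('n Sp \<Rightarrow> complex) \<Rightarrow> _"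
    by unfold_locales
  have "inj (\<lambda>c. sp_coeff c u)"
    using sp_coeff_eq_0_imp_eq_0[OF J_u \<open>u \<noteq> 0\<close>]
    by (subst coeff_map.inj_iff_eq_0) (auto simp: fun_eq_iff)
  then have "fun_space.dim (range (\<lambda>c. sp_coeff c u)) = vec.dim (UNIV :: (complex^('n + 'n)) set)"
    by (intro pair.dim_image_eq linear_sp_coeff) (auto intro: inj_on_subset)
  also have "\<dots> = 2 * CARD('n)"
    by (simp add: card_cart_basis UNIV_Plus_UNIV[symmetric] card_Plus del: UNIV_Plus_UNIV)
  finally have dim: "fun_space.dim (family v) = 2 * CARD('n)"
    by (simp add: family_eq_range u_def)
  have subspace: "fun_space.subspace (family v)"
    unfolding family_eq_range u_def[symmetric]
    by (rule coeff_map.subspace_image) simp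
  have "eigenfamily (family v)"
    unfolding eigenfamily_def
  proof (intro conjI)
    show "\<forall>\<phi>\<in>family v. smooth \<phi>"
      by (auto simp: family_eq_range smooth_sp_coeff)
    show "\<exists>l m. \<forall>B. orthonormal_basis B \<longrightarrow>
        (\<forall>\<phi>\<in>family v. \<forall>p. tension B \<phi> p = l * \<phi> p) \<and>
        (\<forall>\<phi>\<in>family v. \<forall>\<psi>\<in>family v. \<forall>p. conformality B \<phi> \<psi> p = m * \<phi> p * \<psi> p)"
      unfolding family_eq_range u_def[symmetric]
      by (intro exI[of _ "1 / 2"] exI[of _ "- (1 / 2)"])
        (use tension_sp_coeff[OF J_u] conformality_sp_coeff[OF J_u] in blast)
  qed
  then show ?thesis
    using subspace dim by blast
qed

end
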